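(* Let $G$ be a simple graph with vertex set $V$, and let $S\subseteq V$ be nonempty such that $\bar S=V\setminus S$ induces no cycles in $G$ (with $G$ regarded as a digraph in which every undirected edge is replaced by the two oppositely oriented edges). Then $S\in st(L(G))$ and $\sigma(L(G))$ and $\sigma(\mathcal{R}_S(L(G)))$ differ at most by $\mathcal{N}(L(G);S)$. Similarly, $S\in st(\mathcal{L}(G))$ and $\sigma(\mathcal{L}(G))$ and $\sigma(\mathcal{R}_S(\mathcal{L}(G)))$ differ at most by $\mathcal{N}(\mathcal{L}(G);S)$.
   Context: A simple graph is an undirected unweighted graph without loops or multiple edges. For $V=\{v_1,\dots,v_n\}$ and $d(v_i)$ the degree of $v_i$, the combinatorial Laplacian $M_L(G)$ has $(i,i)$ entry $d(v_i)$, $(i,j)$ entry $-1$ if $i\ne j$ and $v_i,v_j$ are adjacent, and $0$ otherwise. The normalized Laplacian $M_{\mathcal{L}}(G)$ has $(i,i)$ entry $1$ if $d(v_i)\ne 0$, $(i,j)$ entry $-1/\sqrt{d(v_i)d(v_j)}$ if $v_i$ is adjacent to $v_j$, and $0$ otherwise. $L(G)$ (resp. $\mathcal{L}(G)$) is the weighted digraph on $V$ whose weighted adjacency matrix is $M_L(G)$ (resp. $M_{\mathcal{L}}(G)$): there is an edge $(v_i,v_j)$ (possibly a loop) exactly when the $(i,j)$ entry is nonzero, with that entry as weight. General setting: $\mathbb{W}$ is the field of complex rational functions in $\lambda$; a weighted digraph $H=(V,E,\omega)$ (no parallel edges, loops allowed, $\omega:E\to\mathbb{W}$, $\omega(e)=0$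 iff $e\notin E$) has adjacency matrix $M(H)_{ij}=\omega(v_i,v_j)$ and spectrum $\sigma(H)$ = list of solutions $\lambda\in\mathbb{C}$ with multiplicity of $\det(M(H)-\lambda I)=0$. For $N\subseteq\mathbb{C}$, two spectra differ at most by $N$ if they coincide (with multiplicities) after deleting all elements lying in $N$. Paths/cycles are sequences of distinct vertices joined by consecutive edges (cycles: first = last vertex; loops are cycles); interior vertices are all but the first and last. A structural set of $H$ is a nonempty $S\subseteq V$ such that $V\setminus S$ induces no cycle in $H$ with loops removed and $\omega(v_i,v_i)\neq\lambda$ for all $v_i\notin S$; $st(H)$ is the set of them. $\mathcal{B}_{ij}(H;S)$ is the set of paths or cycles from $v_i\in S$ to $v_j\in S$ with no interior vertices in $S$; the branch product of $\beta=u_1,\dots,u_k$ is $\omega(u_1,u_2)\prod_{t=2}^{k-1}\omega(u_t,u_{t+1})/(\lambda-\omega(u_t,u_t))$ ($=\omega(u_1,u_2)$ if $k=2$). $\mathcal{R}_S(H)$ is the weighted digraph on $S$ with edge $(v_i,v_j)$ iff $\mathcal{B}_{ij}(H;S)\neq\emptyset$, of weight the sum of the branch products over $\mathcal{B}_{ij}(H;S)$. $\mathcal{N}(H;S)$ is the set of $\lambda\in\mathbb{C}$ such that for some $v_i\notin S$, $\lambda=\omega(v_i,v_i)(\lambda)$ or $\omega(v_i,v_i)$ is undefined at $\lambda$. *)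

theory Defs
  imports
    "HOL-Computational_Algebra.Computational_Algebra"
    "HOL-Computational_Algebra.Field_as_Ring"
    "HOL-Library.Extended_Nat"
    "Graph_Theory.Graph_Theory"
    "Jordan_Normal_Form.Determinant"
begin

section \<open>Complex rational functions\<close>

type_synonym ratfun = "complex poly fract"

definition rf_const :: "complex \<Rightarrow> ratfun" where
  "rf_const c = to_fract [:c:]"

definition rf_lambda :: ratfun where
  "rf_lambda = to_fract [:0, 1:]"

text \<open>\<^const>\<open>quot_of_fract\<close> yields numerator and denominator in lowest terms.\<close>

definition rf_undefined_at :: "ratfun \<Rightarrow> complex \<Rightarrow> bool" where
  "rf_undefined_at r z \<longleftrightarrow> poly (snd (quot_of_fract r)) z = 0"

definition rf_eval :: "ratfun \<Rightarrow> complex \<Rightarrow> complex" where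
  "rf_eval r z = poly (fst (quot_of_fract r)) z / poly (snd (quot_of_fract r)) z"

text \<open>The multiplicity of \<open>z\<close> as a solution of \<open>r(z) = 0\<close>. Every point solves \<open>0 = 0\<close>, with
  infinite multiplicity. A pole is not a solution, and there the numerator has order 0.\<close>

definition rf_zero_mult :: "ratfun \<Rightarrow> complex \<Rightarrow> enat" where
  "rf_zero_mult r z = (if r = 0 then \<infinity> else enat (order z (fst (quot_of_fract r))))"


section \<open>Weighted digraphs and their spectra\<close>

text \<open>The edge set is kept as separate data: \<^term>\<open>weight\<close> is total and takes the value 0
  outside it, but in a reduction an edge may exist although its branch products sum to 0.\<close>

record 'a wdigraph =
  base :: "'a pair_pre_digraph"
  weight :: "'a \<times> 'a \<Rightarrow> ratfun"

definition weighted_digraph :: "'a wdigraph \<Rightarrow> bool" where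
  "weighted_digraph H \<longleftrightarrow>
     pair_fin_digraph (base H) \<and> (\<forall>e. weight H e = 0 \<longleftrightarrow> e \<notin> parcs (base H))"

abbreviation wverts :: "'a wdigraph \<Rightarrow> 'a set" where
  "wverts H \<equiv> pverts (base H)"

text \<open>An arbitrary enumeration \<open>v\<^sub>1, \<dots>, v\<^sub>n\<close> of the (finite) vertex set. The determinant
  below does not depend on its order.\<close>

definition vertex_list :: "'a wdigraph \<Rightarrow> 'a list" where
  "vertex_list H = (SOME vs. distinct vs \<and> set vs = wverts H)"

definition adjacency_mat :: "'a wdigraph \<Rightarrow> ratfun mat" where
  "adjacency_mat H = (let vs = vertex_list H; n = length vs in
     mat n n (\<lambda>(i, j). weight H (vs ! i, vs ! j)))"

definition char_ratfun :: "'a wdigraph \<Rightarrow> ratfun" where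
  "char_ratfun H = (let M = adjacency_mat H in det (M - rf_lambda \<cdot>\<^sub>m 1\<^sub>m (dim_row M)))"

text \<open>A list of complex numbers with multiplicities is represented by its multiplicity function.\<close>

definition wspectrum :: "'a wdigraph \<Rightarrow> complex \<Rightarrow> enat" where
  "wspectrum H = rf_zero_mult (char_ratfun H)"

definition differ_at_most_by :: "(complex \<Rightarrow> enat) \<Rightarrow> (complex \<Rightarrow> enat) \<Rightarrow> complex set \<Rightarrow> bool" where
  "differ_at_most_by \<sigma> \<tau> N \<longleftrightarrow> (\<forall>z. z \<notin> N \<longrightarrow> \<sigma> z = \<tau> z)"


section \<open>Structural sets and reductions\<close>

text \<open>\<^const>\<open>pre_digraph.cycle\<close> counts loops and the closed walks \<open>u, v, u\<close> as cycles.\<close>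

definition induces_no_cycle :: "'a pair_pre_digraph \<Rightarrow> 'a set \<Rightarrow> bool" where
  "induces_no_cycle D U \<longleftrightarrow> \<not> (\<exists>p. pre_digraph.cycle (with_proj D \<restriction> U) p)"

definition remove_loops :: "'a pair_pre_digraph \<Rightarrow> 'a pair_pre_digraph" where
  "remove_loops D = D\<lparr>parcs := parcs D - Id\<rparr>"

definition structural_sets :: "'a wdigraph \<Rightarrow> 'a set set" where
  "structural_sets H = {S. S \<noteq> {} \<and> S \<subseteq> wverts H
     \<and> induces_no_cycle (remove_loops (base H)) (wverts H - S)
     \<and> (\<forall>v \<in> wverts H - S. weight H (v, v) \<noteq> rf_lambda)}"

text \<open>Branches are given by their nonempty arc lists \<open>(u\<^sub>1,u\<^sub>2), (u\<^sub>2,u\<^sub>3), \<dots>, (u\<^sub>k\<^sub>-\<^sub>1,u\<^sub>k)\<close>, which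
  determine and are determined by the vertex sequences \<open>u\<^sub>1, \<dots>, u\<^sub>k\<close> with \<open>k \<ge> 2\<close>.\<close>

definition branches :: "'a wdigraph \<Rightarrow> 'a set \<Rightarrow> 'a \<Rightarrow> 'a \<Rightarrow> ('a \<times> 'a) list set" where
  "branches H S u v = {p. p \<noteq> []
     \<and> (pre_digraph.apath (with_proj (base H)) u p v
        \<or> u = v \<and> pre_digraph.awalk (with_proj (base H)) u p u
                \<and> pre_digraph.cycle (with_proj (base H)) p)
     \<and> set (butlast (tl (pawalk_verts u p))) \<inter> S = {}}"

definition branch_product :: "'a wdigraph \<Rightarrow> ('a \<times> 'a) list \<Rightarrow> ratfun" where
  "branch_product H p =
     weight H (hd p) * (\<Prod>e\<leftarrow>tl p. weight H e / (rf_lambda - weight H (fst e, fst e)))"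

definition reduction :: "'a set \<Rightarrow> 'a wdigraph \<Rightarrow> 'a wdigraph" where
  "reduction S H = \<lparr>
     base = \<lparr>pverts = S, parcs = {(u, v). u \<in> S \<and> v \<in> S \<and> branches H S u v \<noteq> {}}\<rparr>,
     weight = (\<lambda>(u, v). if u \<in> S \<and> v \<in> S
                         then \<Sum>p \<in> branches H S u v. branch_product H p else 0)\<rparr>"

definition exceptional_set :: "'a wdigraph \<Rightarrow> 'a set \<Rightarrow> complex set" where
  "exceptional_set H S = {z. \<exists>v \<in> wverts H - S.
     rf_undefined_at (weight H (v, v)) z \<or> z = rf_eval (weight H (v, v)) z}"


section \<open>Laplacians of simple graphs\<close>

text \<open>A simple graph is a \<^locale>\<open>pair_graph\<close>: a finite loop-free digraph without parallel arcs
  whose arc relation is symmetric, i.e. every undirected edge is given as its two orientations.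
  The out-degree is then the number of neighbours.\<close>

abbreviation degree_of :: "'a pair_pre_digraph \<Rightarrow> 'a \<Rightarrow> nat" where
  "degree_of G v \<equiv> out_degree (with_proj G) v"

definition laplacian :: "'a pair_pre_digraph \<Rightarrow> 'a \<Rightarrow> 'a \<Rightarrow> real" where
  "laplacian G u v =
     (if u = v then real (degree_of G u) else if (u, v) \<in> parcs G then - 1 else 0)"

definition normalized_laplacian :: "'a pair_pre_digraph \<Rightarrow> 'a \<Rightarrow> 'a \<Rightarrow> real" where
  "normalized_laplacian G u v =
     (if u = v \<and> degree_of G u \<noteq> 0 then 1
      else if (u, v) \<in> parcs G then - 1 / sqrt (real (degree_of G u) * real (degree_of G v))
      else 0)"

definition wdigraph_of_matrix :: "'a set \<Rightarrow> ('a \<Rightarrow> 'a \<Rightarrow> real) \<Rightarrow> 'a wdigraph" where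
  "wdigraph_of_matrix V M = \<lparr>
     base = \<lparr>pverts = V, parcs = {(u, v). u \<in> V \<and> v \<in> V \<and> M u v \<noteq> 0}\<rparr>,
     weight = (\<lambda>(u, v). if u \<in> V \<and> v \<in> V then rf_const (complex_of_real (M u v)) else 0)\<rparr>"

definition laplacian_digraph :: "'a pair_pre_digraph \<Rightarrow> 'a wdigraph" where
  "laplacian_digraph G = wdigraph_of_matrix (pverts G) (laplacian G)"

definition normalized_laplacian_digraph :: "'a pair_pre_digraph \<Rightarrow> 'a wdigraph" where
  "normalized_laplacian_digraph G = wdigraph_of_matrix (pverts G) (normalized_laplacian G)"

lemma weighted_digraph_wdigraph_of_matrix:
  assumes "finite V"
  shows "weighted_digraph (wdigraph_of_matrix V M)"
proof -
  have "{(u, v). u \<in> V \<and> v \<in> V \<and> M u v \<noteq> 0} \<subseteq> V \<times> V" by auto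
  then have "finite {(u, v). u \<in> V \<and> v \<in> V \<and> M u v \<noteq> 0}"
    using assms by (meson finite_SigmaI finite_subset)
  then show ?thesis
    using assms
    by (auto simp: weighted_digraph_def wdigraph_of_matrix_def rf_const_def intro!: pair_fin_digraph.intro
        pair_wf_digraph.intro pair_fin_digraph_axioms.intro)
qed

lemma weighted_digraph_laplacians:
  assumes "pair_graph G"
  shows "weighted_digraph (laplacian_digraph G)"
    and "weighted_digraph (normalized_laplacian_digraph G)"
proof -
  interpret pair_graph G by fact
  show "weighted_digraph (laplacian_digraph G)" "weighted_digraph (normalized_laplacian_digraph G)"
    using pair_finite_verts
    by (simp_all add: laplacian_digraph_def normalized_laplacian_digraph_def
        weighted_digraph_wdigraph_of_matrix)
qed

end

theory Submission
  imports Defs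
begin

text \<open>
  Antiparallel arcs form a cycle, so if the complement of \<open>S\<close> induces no cycle in the graph, it
  is an independent set. Hence the block of the (normalized) Laplacian indexed by the complement is
  a diagonal matrix \<open>D\<close>, every branch has at most one interior vertex, and the reduction minus
  \<open>\<lambda>\<close> is the Schur complement of \<open>D - \<lambda>\<close>. The two characteristic functions therefore differ by the
  factor \<open>det (D - \<lambda>)\<close>, which has neither zeros nor poles outside the exceptional set.
\<close>

section \<open>Zero multiplicities of rational functions\<close>

definition rf_unit_at :: "ratfun \<Rightarrow> complex \<Rightarrow> bool" where
  "rf_unit_at r z \<longleftrightarrow> (\<exists>p q. r = Fract p q \<and> poly p z \<noteq> 0 \<and> poly q z \<noteq> 0)"

lemma rf_unit_at_nonzero: "rf_unit_at r z \<Longrightarrow> r \<noteq> 0"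
  unfolding rf_unit_at_def by (metis Zero_fract_def eq_fract(1) mult_zero_left mult_cancel_right
      mult.right_neutral one_neq_zero poly_0)

lemma rf_unit_at_1: "rf_unit_at 1 z"
  by (auto simp: rf_unit_at_def One_fract_def intro!: exI[of _ 1])

lemma rf_unit_at_mult:
  assumes "rf_unit_at r z" "rf_unit_at s z"
  shows "rf_unit_at (r * s) z"
proof -
  obtain p q p' q' where "r = Fract p q" "poly p z \<noteq> 0" "poly q z \<noteq> 0"
    "s = Fract p' q'" "poly p' z \<noteq> 0" "poly q' z \<noteq> 0"
    using assms by (auto simp: rf_unit_at_def)
  then have "r * s = Fract (p * p') (q * q')" "poly (p * p') z \<noteq> 0" "poly (q * q') z \<noteq> 0"
    by simp_all
  then show ?thesis unfolding rf_unit_at_def by blast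
qed

lemma rf_unit_at_prod_list: "(\<And>x. x \<in> set xs \<Longrightarrow> rf_unit_at (f x) z) \<Longrightarrow> rf_unit_at (\<Prod>x\<leftarrow>xs. f x) z"
  by (induction xs) (simp_all add: rf_unit_at_1 rf_unit_at_mult)

text \<open>A common root \<open>z\<close> would make \<open>[:- z, 1:]\<close> a common divisor,
  hence a unit, contradicting its degree.\<close>

lemma order_coprime:
  fixes a b :: "complex poly"
  assumes "coprime a b" "a \<noteq> 0" "b \<noteq> 0"
  shows "order z a = 0 \<or> order z b = 0"
proof (rule ccontr)
  assume "\<not> ?thesis"
  then have "poly a z = 0" "poly b z = 0"
    using assms by (simp_all add: order_root)
  then have "[:- z, 1:] dvd a" "[:- z, 1:] dvd b"
    by (simp_all add: poly_eq_0_iff_dvd)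
  then have "is_unit [:- z, 1:]"
    using assms(1) coprime_common_divisor by blast
  then show False
    by (simp add: is_unit_iff_degree)
qed

text \<open>A unit at \<open>z\<close> preserves the order of the numerator minus that of the
  denominator. In lowest terms one of the two orders is 0, so the order of the numerator is the
  positive part of this difference. This covers poles as well as zeros.\<close>

lemma rf_zero_mult_unit_mult:
  assumes "rf_unit_at u z"
  shows "rf_zero_mult (u * r) z = rf_zero_mult r z"
proof (cases "r = 0")
  case False
  obtain p q where u: "u = Fract p q" and p: "poly p z \<noteq> 0" and q: "poly q z \<noteq> 0"
    using assms by (auto simp: rf_unit_at_def)
  define a b c d where "a = fst (quot_of_fract r)" and "b = snd (quot_of_fract r)"
    and "c = fst (quot_of_fract (u * r))" and "d = snd (quot_of_fract (u * r))"
  have ur: "u * r \<noteq> 0" using False assms rf_unit_at_nonzero by auto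
  have nz: "a \<noteq> 0" "b \<noteq> 0" "c \<noteq> 0" "d \<noteq> 0" "p \<noteq> 0" "q \<noteq> 0"
    using False ur p q by (auto simp: a_def b_def c_def d_def)
  have cop: "coprime a b" "coprime c d"
    by (simp_all add: a_def b_def c_def d_def coprime_quot_of_fract)
  have r: "r = Fract a b" and ur': "u * r = Fract c d"
    by (simp_all add: a_def b_def c_def d_def)
  have "Fract c d = Fract (p * a) (q * b)"
    using ur' unfolding r u by simp
  then have "c * (q * b) = p * a * d"
    using nz by (simp add: eq_fract)
  moreover have "order z (c * (q * b)) = order z c + order z b"
    using nz q by (simp add: order_mult order_0I)
  moreover have "order z (p * a * d) = order z a + order z d"
    using nz p by (simp add: order_mult order_0I)
  ultimately have "order z c + order z b = order z a + order z d"
    by metis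
  moreover have "order z a = 0 \<or> order z b = 0" "order z c = 0 \<or> order z d = 0"
    using order_coprime[OF cop(1)] order_coprime[OF cop(2)] nz by simp_all
  ultimately have "order z c = order z a" by linarith
  then show ?thesis
    using False ur by (simp add: rf_zero_mult_def a_def c_def)
qed (simp add: rf_zero_mult_def)

text \<open>With \<open>r = a / b\<close> in lowest terms, the numerator
  \<open>a - [:0, 1:] * b\<close> takes at \<open>z\<close> the value
  \<open>b(z) (r(z) - z)\<close>. The hypotheses negate the two clauses of
  \<open>exceptional_set\<close>.\<close>

lemma rf_unit_at_diff_lambda:
  assumes "\<not> rf_undefined_at r z" "z \<noteq> rf_eval r z"
  shows "rf_unit_at (r - rf_lambda) z"
proof -
  define a b where "a = fst (quot_of_fract r)" and "b = snd (quot_of_fract r)"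
  have b: "poly b z \<noteq> 0" "b \<noteq> 0"
    using assms by (auto simp: b_def rf_undefined_at_def)
  have "r = Fract a b" by (simp add: a_def b_def)
  then have "r - rf_lambda = Fract (a - [:0, 1:] * b) b"
    using b by (simp add: rf_lambda_def to_fract_def)
  moreover have "poly (a - [:0, 1:] * b) z \<noteq> 0"
    using assms b by (auto simp: rf_eval_def a_def b_def field_simps)
  ultimately show ?thesis
    using b unfolding rf_unit_at_def by blast
qed

section \<open>Determinants indexed by lists\<close>

text \<open>Indexing by a list makes concatenation of lists correspond to the block decomposition of
  the matrix.\<close>

definition list_mat :: "('a \<Rightarrow> 'a \<Rightarrow> 'b) \<Rightarrow> 'a list \<Rightarrow> 'b mat" where
  "list_mat f vs = mat (length vs) (length vs) (\<lambda>(i, j). f (vs ! i) (vs ! j))"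

lemma list_mat_carrier [simp]: "list_mat f vs \<in> carrier_mat (length vs) (length vs)"
  by (simp add: list_mat_def)

text \<open>Reordering the list applies one permutation to both rows and columns, so its sign enters
  squared.\<close>

lemma det_list_mat_mset_eq:
  fixes f :: "'a \<Rightarrow> 'a \<Rightarrow> 'b :: comm_ring_1"
  assumes "mset vs = mset ws"
  shows "det (list_mat f vs) = det (list_mat f ws)"
proof -
  define n where "n = length ws"
  obtain p where p: "p permutes {..<length ws}" and vs: "permute_list p ws = vs"
    using mset_eq_permutation[OF assms] by blast
  have p': "p permutes {0..<n}" using p by (simp add: n_def atLeast0LessThan)
  have len: "length vs = n" using vs by (auto simp: n_def)
  have lt: "p i < n" if "i < n" for i
    using permutes_in_image[OF p', of i] that by simp
  \<comment> \<open>Only the rows are permuted in \<open>B\<close>; the columns follow as rows of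
    its transpose.\<close>
  define B where "B = mat n n (\<lambda>(i, j). list_mat f ws $$ (p i, j))"
  have detB: "det B = signof p * det (list_mat f ws)"
    unfolding B_def by (rule det_permute_rows[OF _ p']) (simp add: n_def)
  have "transpose_mat (list_mat f vs) = mat n n (\<lambda>(i, j). transpose_mat B $$ (p i, j))"
    using p lt by (intro eq_matI)
      (auto simp: B_def list_mat_def n_def len vs[symmetric] permute_list_nth)
  then have "det (transpose_mat (list_mat f vs)) = signof p * det (transpose_mat B)"
    using det_permute_rows[OF _ p', of "transpose_mat B"] by (simp add: B_def)
  moreover have "det (transpose_mat (list_mat f vs)) = det (list_mat f vs)"
    by (rule det_transpose[OF list_mat_carrier])
  moreover have "det (transpose_mat B) = det B"
    by (rule det_transpose[of _ n]) (simp add: B_def)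
  ultimately have "det (list_mat f vs) = signof p * signof p * det (list_mat f ws)"
    by (simp add: detB mult.assoc)
  also have "(signof p :: 'b) * signof p = 1"
    by (simp add: sign_def)
  finally show ?thesis by simp
qed

text \<open>Column operations by a unit lower triangular block matrix clear the lower left block.
  What remains is block upper triangular, with the diagonal block of \<open>ts\<close> and its Schur
  complement on the diagonal.\<close>

lemma det_list_mat_Schur_diagonal:
  fixes f :: "'a \<Rightarrow> 'a \<Rightarrow> 'b :: field"
  assumes ts: "distinct ts"
    and off: "\<And>u v. u \<in> set ts \<Longrightarrow> v \<in> set ts \<Longrightarrow> u \<noteq> v \<Longrightarrow> f u v = 0"
    and diag: "\<And>v. v \<in> set ts \<Longrightarrow> f v v \<noteq> 0"
  shows "det (list_mat f (ss @ ts)) = (\<Prod>v\<leftarrow>ts. f v v) *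
    det (list_mat (\<lambda>u v. f u v - (\<Sum>w\<in>set ts. f u w * f w v / f w w)) ss)"
proof -
  let ?n = "length ss" and ?m = "length ts"
  define A where "A = list_mat f ss"
  define B where "B = mat ?n ?m (\<lambda>(i, j). f (ss ! i) (ts ! j))"
  define C where "C = mat ?m ?n (\<lambda>(i, j). f (ts ! i) (ss ! j))"
  define D where "D = list_mat f ts"
  \<comment> \<open>This is \<open>- D^(-1) * C\<close>: as \<open>D\<close> is diagonal, its
    inverse divides row \<open>i\<close> by the \<open>i\<close>-th diagonal entry.\<close>
  define E where "E = mat ?m ?n (\<lambda>(i, j). - f (ts ! i) (ss ! j) / f (ts ! i) (ts ! i))"
  define R where "R = list_mat (\<lambda>u v. f u v - (\<Sum>w\<in>set ts. f u w * f w v / f w w)) ss"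
  have car: "A \<in> carrier_mat ?n ?n" "B \<in> carrier_mat ?n ?m" "C \<in> carrier_mat ?m ?n"
    "D \<in> carrier_mat ?m ?m" "E \<in> carrier_mat ?m ?n"
    by (simp_all add: A_def B_def C_def D_def E_def)
  have split: "list_mat f (ss @ ts) = four_block_mat A B C D"
    by (rule eq_matI) (auto simp: A_def B_def C_def D_def list_mat_def nth_append)
  have Dnth: "f (ts ! i) (ts ! j) = (if i = j then f (ts ! i) (ts ! i) else 0)"
    if "i < ?m" "j < ?m" for i j
    using that off ts by (auto simp: nth_eq_iff_index_eq)
  have set_sum: "(\<Sum>k = 0..<?m. g (ts ! k)) = (\<Sum>w\<in>set ts. g w)" for g :: "'a \<Rightarrow> 'b"
    using ts by (intro sum.reindex_bij_betw bij_betw_nth) auto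
  have "A * 1\<^sub>m ?n + B * E = R"
  proof (rule eq_matI)
    fix i j assume "i < dim_row R" "j < dim_col R"
    then have ij: "i < ?n" "j < ?n" by (simp_all add: R_def list_mat_def)
    have "(A * 1\<^sub>m ?n + B * E) $$ (i, j) = f (ss ! i) (ss ! j) +
        (\<Sum>k = 0..<?m. - (f (ss ! i) (ts ! k) * f (ts ! k) (ss ! j) / f (ts ! k) (ts ! k)))"
      using ij car by (simp add: A_def list_mat_def B_def E_def scalar_prod_def)
    also have "\<dots> = R $$ (i, j)"
      using ij set_sum[of "\<lambda>w. - (f (ss ! i) w * f w (ss ! j) / f w w)"]
      by (simp add: R_def list_mat_def sum_negf)
    finally show "(A * 1\<^sub>m ?n + B * E) $$ (i, j) = R $$ (i, j)" .
  qed (use car in \<open>auto simp: R_def list_mat_def\<close>)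
  moreover have "A * 0\<^sub>m ?n ?m + B * 1\<^sub>m ?m = B"
    using car by simp
  moreover have "C * 1\<^sub>m ?n + D * E = 0\<^sub>m ?m ?n"
  proof (rule eq_matI)
    fix i j assume "i < dim_row (0\<^sub>m ?m ?n)" "j < dim_col (0\<^sub>m ?m ?n)"
    then have ij: "i < ?m" "j < ?n" by simp_all
    have "(C * 1\<^sub>m ?n + D * E) $$ (i, j) = f (ts ! i) (ss ! j) +
        (\<Sum>k = 0..<?m. f (ts ! i) (ts ! k) * (- f (ts ! k) (ss ! j) / f (ts ! k) (ts ! k)))"
      using ij car by (simp add: C_def D_def list_mat_def E_def scalar_prod_def)
    \<comment> \<open>Only the term \<open>k = i\<close> survives because \<open>D\<close> is
      diagonal; there the nonzero diagonal entry cancels.\<close>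
    also have "(\<Sum>k = 0..<?m. f (ts ! i) (ts ! k) * (- f (ts ! k) (ss ! j) / f (ts ! k) (ts ! k)))
      = (\<Sum>k = 0..<?m. if k = i then - f (ts ! i) (ss ! j) else 0)"
    proof (rule sum.cong[OF refl])
      fix k assume "k \<in> {0..<?m}"
      then show "f (ts ! i) (ts ! k) * (- f (ts ! k) (ss ! j) / f (ts ! k) (ts ! k))
          = (if k = i then - f (ts ! i) (ss ! j) else 0)"
        using ij diag[of "ts ! i"] Dnth[of i k] by auto
    qed
    also have "f (ts ! i) (ss ! j) + \<dots> = 0"
      using ij by simp
    finally show "(C * 1\<^sub>m ?n + D * E) $$ (i, j) = 0\<^sub>m ?m ?n $$ (i, j)"
      using ij by simp
  qed (use car in auto)
  moreover have "C * 0\<^sub>m ?n ?m + D * 1\<^sub>m ?m = D"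
    using car by simp
  ultimately have prod: "four_block_mat A B C D * four_block_mat (1\<^sub>m ?n) (0\<^sub>m ?n ?m) E (1\<^sub>m ?m)
      = four_block_mat R B (0\<^sub>m ?m ?n) D"
    using car by (subst mult_four_block_mat[of _ ?n ?n _ ?m _ ?m _ _ ?n _ ?m]) auto
  have "det (four_block_mat A B C D) * det (four_block_mat (1\<^sub>m ?n) (0\<^sub>m ?n ?m) E (1\<^sub>m ?m))
      = det (four_block_mat R B (0\<^sub>m ?m ?n) D)"
    unfolding prod[symmetric]
    by (rule det_mult[symmetric, of _ "?n + ?m"]) (use car in auto)
  moreover have "det (four_block_mat (1\<^sub>m ?n) (0\<^sub>m ?n ?m) E (1\<^sub>m ?m)) = 1"
    using car by (subst det_four_block_mat_upper_right_zero[of _ ?n _ ?m]) auto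
  moreover have "det (four_block_mat R B (0\<^sub>m ?m ?n) D) = det R * det D"
    using car by (intro det_four_block_mat_lower_left_zero[of _ ?n _ ?m]) (auto simp: R_def)
  moreover have "det D = (\<Prod>v\<leftarrow>ts. f v v)"
  proof -
    have "det D = prod_list (diag_mat D)"
      using Dnth by (intro det_upper_triangular[of _ ?m]) (auto simp: D_def list_mat_def)
    also have "diag_mat D = map (\<lambda>v. f v v) ts"
      by (rule nth_equalityI) (auto simp: diag_mat_def D_def list_mat_def)
    finally show ?thesis .
  qed
  ultimately show ?thesis
    by (simp add: split R_def mult.commute)
qed

section \<open>Characteristic functions over arbitrary vertex enumerations\<close>

lemma vertex_list:
  assumes "finite (wverts H)"
  shows "distinct (vertex_list H)" "set (vertex_list H) = wverts H"
  using someI_ex[of "\<lambda>vs. distinct vs \<and> set vs = wverts H"] finite_distinct_list[OF assms]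
  unfolding vertex_list_def by blast+

text \<open>This frees the characteristic function from the enumeration chosen by
  \<open>SOME\<close>, so that the vertices of \<open>S\<close> can be listed first.\<close>

lemma char_ratfun_list_mat:
  assumes "finite (wverts H)" "distinct vs" "set vs = wverts H"
  shows "char_ratfun H
    = det (list_mat (\<lambda>u v. weight H (u, v) - (if u = v then rf_lambda else 0)) vs)"
proof -
  let ?f = "\<lambda>u v. weight H (u, v) - (if u = v then rf_lambda else 0)"
  note vl = vertex_list[OF assms(1)]
  have "adjacency_mat H - rf_lambda \<cdot>\<^sub>m 1\<^sub>m (dim_row (adjacency_mat H)) = list_mat ?f (vertex_list H)"
    using vl(1) by (intro eq_matI)
      (auto simp: adjacency_mat_def list_mat_def Let_def nth_eq_iff_index_eq)
  then have "char_ratfun H = det (list_mat ?f (vertex_list H))"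
    by (simp add: char_ratfun_def Let_def)
  also have "\<dots> = det (list_mat ?f vs)"
    using vl assms by (intro det_list_mat_mset_eq) (metis set_eq_iff_mset_eq_distinct)
  finally show ?thesis .
qed

section \<open>Reductions with independent complement\<close>

lemma awalk_with_proj:
  "pre_digraph.awalk (with_proj D) u p v \<longleftrightarrow> u \<in> pverts D \<and> set p \<subseteq> parcs D \<and> pcas u p v"
  by (simp add: pre_digraph.awalk_def cas_with_proj_eq)

lemma cycle_with_proj:
  "pre_digraph.cycle (with_proj D) p \<longleftrightarrow>
    (\<exists>u. u \<in> pverts D \<and> set p \<subseteq> parcs D \<and> pcas u p u \<and> distinct (tl (pawalk_verts u p)) \<and> p \<noteq> [])"
  by (simp add: pre_digraph.cycle_def awalk_with_proj awalk_verts_with_proj_eq)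

lemma apath_with_proj:
  "pre_digraph.apath (with_proj D) u p v \<longleftrightarrow>
    u \<in> pverts D \<and> set p \<subseteq> parcs D \<and> pcas u p v \<and> distinct (pawalk_verts u p)"
  by (simp add: pre_digraph.apath_def awalk_with_proj awalk_verts_with_proj_eq)

text \<open>Two consecutive interior vertices would be distinct and joined by an arc outside
  \<open>S\<close>, so a branch has at most one. The conclusion \<open>x = y\<close> of
  \<open>indep\<close> leaves room for the loops that the diagonal entries create.\<close>

lemma branches_independent_complement:
  assumes arcs: "parcs (base H) \<subseteq> wverts H \<times> wverts H"
    and S: "S \<subseteq> wverts H" "u \<in> S" "v \<in> S"
    and indep: "\<And>x y. (x, y) \<in> parcs (base H) \<Longrightarrow> x \<notin> S \<Longrightarrow> y \<notin> S \<Longrightarrow> x = y"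
  shows "branches H S u v = {p. p = [(u, v)] \<and> (u, v) \<in> parcs (base H)}
    \<union> (\<lambda>w. [(u, w), (w, v)]) `
        {w \<in> wverts H - S. (u, w) \<in> parcs (base H) \<and> (w, v) \<in> parcs (base H)}"
    (is "_ = ?R")
proof (intro Set.set_eqI iffI)
  fix p assume "p \<in> branches H S u v"
  \<comment> \<open>Distinctness of the tail is what paths and cycles share: in a cycle the first
    vertex recurs as the last.\<close>
  then have p: "p \<noteq> []" "set p \<subseteq> parcs (base H)" "pcas u p v" "distinct (tl (pawalk_verts u p))"
      "set (butlast (tl (pawalk_verts u p))) \<inter> S = {}"
    unfolding branches_def apath_with_proj awalk_with_proj cycle_with_proj
    by (auto simp: distinct_tl neq_Nil_conv)
  have [simp]: "pawalk_verts x q \<noteq> []" for x :: 'a and q by (cases q) auto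
  show "p \<in> ?R"
  proof (cases p)
    case (Cons e p')
    note e = this
    show ?thesis
    proof (cases p')
      case Nil
      then show ?thesis using p e by (cases e) auto
    next
      case (Cons e' p'')
      obtain w where ew: "e = (u, w)" using p e by (cases e) auto
      obtain x where ex: "e' = (w, x)" using p e ew Cons by (cases e') auto
      have w: "w \<notin> S" "w \<in> wverts H" using p e ew Cons ex arcs by (auto split: if_splits)
      show ?thesis
      proof (cases p'')
        case Nil
        then show ?thesis using p e Cons ew ex w by auto
      next
        case (Cons e'' q)
        \<comment> \<open>The third arc \<open>e''\<close> makes \<open>x\<close> interior
          too.\<close>
        have "x \<notin> S" "w \<noteq> x"
          using p e \<open>p' = e' # p''\<close> Cons ew ex by (auto split: if_splits)
        then show ?thesis
          using indep[of w x] w p e \<open>p' = e' # p''\<close> ex by auto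
      qed
    qed
  qed (use p in auto)
next
  fix p assume "p \<in> ?R"
  then consider "p = [(u, v)]" "(u, v) \<in> parcs (base H)"
    | w where "p = [(u, w), (w, v)]" "w \<notin> S" "(u, w) \<in> parcs (base H)" "(w, v) \<in> parcs (base H)"
    by blast
  then show "p \<in> branches H S u v"
  proof cases
    case 1
    then show ?thesis
      using S unfolding branches_def apath_with_proj awalk_with_proj cycle_with_proj by auto
  next
    case 2
    then show ?thesis
      using S unfolding branches_def apath_with_proj awalk_with_proj cycle_with_proj
      \<comment> \<open>If \<open>u = v\<close>, the branch is a cycle, and \<open>u\<close> is its
        base point.\<close>
      by (auto intro!: exI[of _ u])
  qed
qed

text \<open>The direct arc and the branches through one interior vertex give the two summands.
  Missing arcs have weight 0, so the sum may run over the whole complement of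
  \<open>S\<close>.\<close>

lemma weight_reduction_independent_complement:
  assumes H: "weighted_digraph H"
    and S: "S \<subseteq> wverts H" "u \<in> S" "v \<in> S"
    and indep: "\<And>x y. (x, y) \<in> parcs (base H) \<Longrightarrow> x \<notin> S \<Longrightarrow> y \<notin> S \<Longrightarrow> x = y"
  shows "weight (reduction S H) (u, v) = weight H (u, v)
    + (\<Sum>w \<in> wverts H - S. weight H (u, w) * weight H (w, v) / (rf_lambda - weight H (w, w)))"
proof -
  interpret pair_fin_digraph "base H" using H by (simp add: weighted_digraph_def)
  have arcs: "parcs (base H) \<subseteq> wverts H \<times> wverts H"
    using in_arcsD1 in_arcsD2 by auto
  have zero: "weight H e = 0 \<longleftrightarrow> e \<notin> parcs (base H)" for e
    using H unfolding weighted_digraph_def by blast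
  define W where "W = {w \<in> wverts H - S. (u, w) \<in> parcs (base H) \<and> (w, v) \<in> parcs (base H)}"
  define P1 where "P1 = {p. p = [(u, v)] \<and> (u, v) \<in> parcs (base H)}"
  define P2 where "P2 = (\<lambda>w. [(u, w), (w, v)]) ` W"
  have fin: "finite P1" "finite P2" "finite W"
    by (simp_all add: P1_def P2_def W_def)
  have "weight (reduction S H) (u, v) = sum (branch_product H) (P1 \<union> P2)"
    unfolding P1_def P2_def W_def
    using S by (simp add: reduction_def branches_independent_complement[OF arcs S indep])
  also have "\<dots> = sum (branch_product H) P1 + sum (branch_product H) P2"
    \<comment> \<open>The branches in \<open>P1\<close> have one arc, those in \<open>P2\<close>
      two.\<close>
    using fin by (intro sum.union_disjoint) (auto simp: P1_def P2_def)
  also have "sum (branch_product H) P1 = weight H (u, v)"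
    using zero[of "(u, v)"] by (auto simp: P1_def branch_product_def)
  also have "sum (branch_product H) P2
      = (\<Sum>w\<in>W. weight H (u, w) * weight H (w, v) / (rf_lambda - weight H (w, w)))"
    unfolding P2_def by (subst sum.reindex) (auto simp: inj_on_def branch_product_def)
  also have "\<dots> = (\<Sum>w \<in> wverts H - S.
      weight H (u, w) * weight H (w, v) / (rf_lambda - weight H (w, w)))"
    using zero by (intro sum.mono_neutral_left) (auto simp: W_def)
  finally show ?thesis .
qed

text \<open>The Schur complement formula writes \<open>char_ratfun H\<close> as
  \<open>char_ratfun (reduction S H)\<close> times the product of the diagonal entries outside
  \<open>S\<close>, each of which is a unit at every non-exceptional \<open>z\<close>.\<close>

lemma wspectrum_reduction_independent_complement:
  assumes H: "weighted_digraph H" and S: "S \<subseteq> wverts H"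
    and indep: "\<And>x y. (x, y) \<in> parcs (base H) \<Longrightarrow> x \<notin> S \<Longrightarrow> y \<notin> S \<Longrightarrow> x = y"
  shows "differ_at_most_by (wspectrum H) (wspectrum (reduction S H)) (exceptional_set H S)"
  unfolding differ_at_most_by_def
proof (intro allI impI)
  fix z assume z: "z \<notin> exceptional_set H S"
  interpret pair_fin_digraph "base H" using H by (simp add: weighted_digraph_def)
  have zero: "weight H e = 0 \<longleftrightarrow> e \<notin> parcs (base H)" for e
    using H unfolding weighted_digraph_def by blast
  define f where "f u v = weight H (u, v) - (if u = v then rf_lambda else 0)" for u v
  have finV: "finite (wverts H)" by simp
  have finS: "finite S" using S finV finite_subset by blast
  obtain ss where ss: "distinct ss" "set ss = S" using finite_distinct_list[OF finS] by blast
  obtain ts where ts: "distinct ts" "set ts = wverts H - S"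
    using finite_distinct_list[of "wverts H - S"] finV by auto
  have unit: "rf_unit_at (f v v) z" if "v \<in> set ts" for v
    using that z ts by (auto simp: f_def exceptional_set_def intro!: rf_unit_at_diff_lambda)
  have "char_ratfun H = det (list_mat f (ss @ ts))"
    unfolding f_def using ss ts S by (intro char_ratfun_list_mat[OF finV]) auto
  also have "\<dots> = (\<Prod>v\<leftarrow>ts. f v v) *
      det (list_mat (\<lambda>u v. f u v - (\<Sum>w\<in>set ts. f u w * f w v / f w w)) ss)"
  proof (rule det_list_mat_Schur_diagonal[OF ts(1)])
    fix u v assume "u \<in> set ts" "v \<in> set ts" "u \<noteq> v"
    then show "f u v = 0" using indep[of u v] zero ts by (auto simp: f_def)
  \<comment> \<open>Being a unit at the single point \<open>z\<close> already makes a diagonal entry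
    nonzero as a rational function, so it can be divided by.\<close>
  qed (use unit rf_unit_at_nonzero in blast)
  also have "list_mat (\<lambda>u v. f u v - (\<Sum>w\<in>set ts. f u w * f w v / f w w)) ss
      = list_mat (\<lambda>u v. weight (reduction S H) (u, v) - (if u = v then rf_lambda else 0)) ss"
  proof -
    have "f u v - (\<Sum>w\<in>set ts. f u w * f w v / f w w)
        = weight (reduction S H) (u, v) - (if u = v then rf_lambda else 0)"
      if uv: "u \<in> S" "v \<in> S" for u v
    proof -
      \<comment> \<open>The entry \<open>f w w\<close> is the negative of the denominator in a
        branch product, which turns the minus of the Schur complement into the plus of the
        reduction. Off the diagonal \<open>f\<close> agrees with the weight, and \<open>u\<close>,
        \<open>v\<close> differ from \<open>w\<close> as they lie in \<open>S\<close>.\<close>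
      have "(\<Sum>w\<in>set ts. f u w * f w v / f w w) =
        (\<Sum>w\<in>set ts. - (weight H (u, w) * weight H (w, v) / (rf_lambda - weight H (w, w))))"
      proof (rule sum.cong[OF refl])
        fix w assume "w \<in> set ts"
        then have "f u w = weight H (u, w)" "f w v = weight H (w, v)"
          using uv ts by (auto simp: f_def)
        moreover have "f w w = - (rf_lambda - weight H (w, w))" by (simp add: f_def)
        ultimately show "f u w * f w v / f w w
            = - (weight H (u, w) * weight H (w, v) / (rf_lambda - weight H (w, w)))"
          by (simp only: divide_minus_right)
      qed
      then show ?thesis
        using weight_reduction_independent_complement[OF H S uv indep] ts
        by (simp add: f_def sum_negf)
    qed
    then show ?thesis
      unfolding list_mat_def using ss(2) by (intro eq_matI) auto
  qed
  also have "det \<dots> = char_ratfun (reduction S H)"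
    using finS ss by (intro char_ratfun_list_mat[symmetric]) (simp_all add: reduction_def)
  finally show "wspectrum H z = wspectrum (reduction S H) z"
    using rf_zero_mult_unit_mult[OF rf_unit_at_prod_list[of ts "\<lambda>v. f v v", OF unit]]
    by (simp add: wspectrum_def)
qed

section \<open>Matrices supported on a graph\<close>

text \<open>An arc and its reverse form the closed walk \<open>u, v, u\<close>, which counts as a
  cycle.\<close>

lemma induces_no_cycle_symmetric_imp_independent:
  assumes "induces_no_cycle D U" "sym (parcs D)" "u \<in> U" "v \<in> U"
  shows "(u, v) \<notin> parcs D"
proof
  assume uv: "(u, v) \<in> parcs D"
  then have vu: "(v, u) \<in> parcs D" using assms(2) by (auto dest: symD)
  \<comment> \<open>For \<open>u = v\<close> the loop must be taken only once, since going around
    twice would repeat \<open>u\<close> in the tail of the vertex list.\<close>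
  have "pre_digraph.cycle (with_proj D \<restriction> U) (if u = v then [(u, v)] else [(u, v), (v, u)])"
    using uv vu assms(3,4)
    by (auto simp: pre_digraph.cycle_def pre_digraph.awalk_def pre_digraph.cas.simps
        pre_digraph.awalk_verts.simps intro!: exI[of _ u])
  then show False using assms(1) unfolding induces_no_cycle_def by blast
qed

lemma induces_no_cycle_if_no_arcs:
  assumes "\<And>u v. u \<in> U \<Longrightarrow> v \<in> U \<Longrightarrow> (u, v) \<notin> parcs D"
  shows "induces_no_cycle D U"
  unfolding induces_no_cycle_def
proof
  assume "\<exists>p. pre_digraph.cycle (with_proj D \<restriction> U) p"
  then obtain p where "set p \<subseteq> arcs (with_proj D \<restriction> U)" "p \<noteq> []"
    by (auto simp: pre_digraph.cycle_def pre_digraph.awalk_def)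
  then show False using assms by (cases p) auto
qed

lemma rf_const_neq_lambda: "rf_const c \<noteq> rf_lambda"
  by (simp add: rf_const_def rf_lambda_def)

text \<open>This treats both Laplacians at once. Outside \<open>S\<close> only loops can remain,
  which \<open>remove_loops\<close> discards, and their constant weights differ from
  \<open>rf_lambda\<close>.\<close>

lemma wdigraph_of_matrix_reduction:
  assumes V: "finite V" and S: "S \<subseteq> V" "S \<noteq> {}"
    and indep: "\<And>u v. u \<in> V - S \<Longrightarrow> v \<in> V - S \<Longrightarrow> u \<noteq> v \<Longrightarrow> M u v = 0"
  defines "H \<equiv> wdigraph_of_matrix V M"
  shows "S \<in> structural_sets H"
    and "differ_at_most_by (wspectrum H) (wspectrum (reduction S H)) (exceptional_set H S)"
proof -
  have V_H: "wverts H = V" by (simp add: H_def wdigraph_of_matrix_def)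
  have "induces_no_cycle (remove_loops (base H)) (wverts H - S)"
    using indep
    by (intro induces_no_cycle_if_no_arcs) (auto simp: remove_loops_def H_def wdigraph_of_matrix_def)
  moreover have "weight H (v, v) \<noteq> rf_lambda" if "v \<in> V" for v
    using that rf_const_neq_lambda by (simp add: H_def wdigraph_of_matrix_def)
  ultimately show "S \<in> structural_sets H"
    using S by (simp add: structural_sets_def V_H)
  show "differ_at_most_by (wspectrum H) (wspectrum (reduction S H)) (exceptional_set H S)"
  proof (rule wspectrum_reduction_independent_complement)
    show "weighted_digraph H"
      unfolding H_def by (rule weighted_digraph_wdigraph_of_matrix[OF V])
    show "S \<subseteq> wverts H" using S by (simp add: V_H)
    show "x = y" if "(x, y) \<in> parcs (base H)" "x \<notin> S" "y \<notin> S" for x y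
      using that indep[of x y] by (auto simp: H_def wdigraph_of_matrix_def)
  qed
qed

theorem theorem2:
  fixes G :: "'a pair_pre_digraph" and S :: "'a set"
  assumes "pair_graph G"
    and "S \<subseteq> pverts G" and "S \<noteq> {}"
    and "induces_no_cycle G (pverts G - S)"
  shows "S \<in> structural_sets (laplacian_digraph G)
    \<and> differ_at_most_by (wspectrum (laplacian_digraph G))
        (wspectrum (reduction S (laplacian_digraph G)))
        (exceptional_set (laplacian_digraph G) S)
    \<and> S \<in> structural_sets (normalized_laplacian_digraph G)
    \<and> differ_at_most_by (wspectrum (normalized_laplacian_digraph G))
        (wspectrum (reduction S (normalized_laplacian_digraph G)))
        (exceptional_set (normalized_laplacian_digraph G) S)"
proof -
  interpret pair_graph G by fact
  have "sym (parcs G)"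
    using sym_arcs by (simp add: symmetric_def)
  then have no_arc: "(u, v) \<notin> parcs G" if "u \<in> pverts G - S" "v \<in> pverts G - S" for u v
    using induces_no_cycle_symmetric_imp_independent assms(4) that by fast
  \<comment> \<open>Off the diagonal, both Laplacians are supported on the arcs of
    \<open>G\<close>.\<close>
  have "laplacian G u v = 0" "normalized_laplacian G u v = 0"
    if "u \<in> pverts G - S" "v \<in> pverts G - S" "u \<noteq> v" for u v
    using no_arc that by (simp_all add: laplacian_def normalized_laplacian_def)
  then show ?thesis
    unfolding laplacian_digraph_def normalized_laplacian_digraph_def
    using wdigraph_of_matrix_reduction[OF pair_finite_verts assms(2,3)] by blast
qed

end
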